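(* Let $R$ be a ring, $m\ge 3$, and let $\mathcal{C}=(c_{i,j})$ be a noncommutative frieze pattern of height $m-3$ over $R$ (indices modulo $m$, with $c_{i,i}=0$ for all $i$). (a) (Propagation along rows) For all $i,j$ with $j\not\equiv i \pmod m$ we have $$(c_{i,j-1},c_{i,j}) \begin{pmatrix} 0 & -c_{j,j-1}^{-1}c_{j,j+1} \\ 1 & c_{j-1,j}^{-1}c_{j-1,j+1}\end{pmatrix} = (c_{i,j},c_{i,j+1}).$$ (b) (Propagation along columns) For all $i,k$ with $k\not\equiv i \pmod m$ we have $$\begin{pmatrix} 0 & 1 \\ -c_{i+1,i}c_{i-1,i}^{-1} & c_{i+1,i-1}c_{i,i-1}^{-1}\end{pmatrix}\begin{pmatrix} c_{i-1,k} \\ c_{i,k} \end{pmatrix} = \begin{pmatrix} c_{i,k} \\ c_{i+1,k} \end{pmatrix}.$$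
   Context: $R$ is an associative unital, not necessarily commutative, ring and $R^{\ast}$ is its group of invertible elements. Let $m\ge 3$. The vertices of an $m$-gon are numbered consecutively $0,1,\dots,m-1$, and indices are taken modulo $m$. A noncommutative frieze pattern of height $m-3$ over $R$ is a family of invertible elements $c_{i,j}\in R^{\ast}$, one for each ordered pair of distinct vertices $i,j$ (arranged in an array whose row $i$ is $0=c_{i,i},c_{i,i+1},c_{i,i+2},\dots,c_{i,i+m-1},c_{i,i+m}=0$, each row being shifted one step to the right of the previous one, so that equal column indices are aligned), satisfying: Local triangle relations, for all three consecutive vertices $i,i+1,i+2$: $$c_{i+1,i+2}c_{i,i+2}^{-1}c_{i,i+1} = c_{i+1,i}c_{i+2,i}^{-1}c_{i+2,i+1}.$$ Local noncommutative exchange relations, for all quadrangles with (four distinct) vertices $i,i+1,j,j+1$: $$c_{j,i} = c_{j,j+1}c_{i+1,j+1}^{-1}c_{i+1,i} + c_{j,i+1} c_{j+1,i+1}^{-1}c_{j+1,i},$$ $$c_{i,j} = c_{i,i+1}c_{j+1,i+1}^{-1}c_{j+1,j} + c_{i,j+1} c_{i+1,j+1}^{-1}c_{i+1,j},$$ $$c_{i+1,j+1} = c_{i+1,i}c_{j,i}^{-1}c_{j,j+1} + c_{i+1,j} c_{i,j}^{-1}c_{i,j+1},$$ $$c_{j+1,i+1} = c_{j+1,j}c_{i,j}^{-1}c_{i,i+1} + c_{j+1,i} c_{j,i}^{-1}c_{j,i+1}.$$ *)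

theory Defs
  imports "HOL-Number_Theory.Cong" "Jordan_Normal_Form.Matrix"
begin

text \<open>
  The sort \<open>{ring, monoid_mult}\<close> is that of associative unital, not necessarily commutative
  rings. In contrast to \<open>ring_1\<close> it does not exclude the zero ring.
\<close>

definition invertible_elem :: "'a::monoid_mult \<Rightarrow> bool" where
  "invertible_elem x \<longleftrightarrow> (\<exists>y. x * y = 1 \<and> y * x = 1)"

text \<open>Meaningful only on invertible elements, where the two-sided inverse is unique.\<close>

definition inv_elem :: "'a::monoid_mult \<Rightarrow> 'a" where
  "inv_elem x = (THE y. x * y = 1 \<and> y * x = 1)"

text \<open>
  Families indexed by pairs of vertices of the \<open>m\<close>-gon are functions on pairs of integers that
  depend only on the residue classes of the two indices modulo \<open>m\<close>.
\<close>

definition indexed_mod :: "nat \<Rightarrow> (int \<Rightarrow> int \<Rightarrow> 'a) \<Rightarrow> bool" where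
  "indexed_mod m c \<longleftrightarrow>
     (\<forall>i i' j j'. [i = i'] (mod int m) \<longrightarrow> [j = j'] (mod int m) \<longrightarrow> c i j = c i' j')"

definition local_triangle_relations :: "(int \<Rightarrow> int \<Rightarrow> 'a::{ring, monoid_mult}) \<Rightarrow> bool" where
  "local_triangle_relations c \<longleftrightarrow>
     (\<forall>i. c (i+1) (i+2) * inv_elem (c i (i+2)) * c i (i+1)
          = c (i+1) i * inv_elem (c (i+2) i) * c (i+2) (i+1))"

text \<open>
  The vertices \<open>i\<close>, \<open>i + 1\<close>, \<open>j\<close>, \<open>j + 1\<close> are pairwise distinct modulo \<open>m\<close> (for \<open>m \<ge> 2\<close>) exactly if
  \<open>j\<close> is none of \<open>i\<close>, \<open>i + 1\<close>, \<open>i - 1\<close>; the last condition is written as \<open>j + 1 \<noteq> i\<close>.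
\<close>

definition local_exchange_relations ::
    "nat \<Rightarrow> (int \<Rightarrow> int \<Rightarrow> 'a::{ring, monoid_mult}) \<Rightarrow> bool" where
  "local_exchange_relations m c \<longleftrightarrow>
     (\<forall>i j. \<not> [j = i] (mod int m) \<longrightarrow> \<not> [j = i + 1] (mod int m) \<longrightarrow> \<not> [j + 1 = i] (mod int m) \<longrightarrow>
        c j i = c j (j+1) * inv_elem (c (i+1) (j+1)) * c (i+1) i
              + c j (i+1) * inv_elem (c (j+1) (i+1)) * c (j+1) i \<and>
        c i j = c i (i+1) * inv_elem (c (j+1) (i+1)) * c (j+1) j
              + c i (j+1) * inv_elem (c (i+1) (j+1)) * c (i+1) j \<and>
        c (i+1) (j+1) = c (i+1) i * inv_elem (c j i) * c j (j+1)
              + c (i+1) j * inv_elem (c i j) * c i (j+1) \<and>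
        c (j+1) (i+1) = c (j+1) j * inv_elem (c i j) * c i (i+1)
              + c (j+1) i * inv_elem (c j i) * c j (i+1))"

text \<open>Noncommutative frieze patterns of height \<open>m - 3\<close>, for \<open>m \<ge> 3\<close>.\<close>

definition nc_frieze_pattern ::
    "nat \<Rightarrow> (int \<Rightarrow> int \<Rightarrow> 'a::{ring, monoid_mult}) \<Rightarrow> bool" where
  "nc_frieze_pattern m c \<longleftrightarrow>
     indexed_mod m c \<and>
     (\<forall>i. c i i = 0) \<and>
     (\<forall>i j. \<not> [j = i] (mod int m) \<longrightarrow> invertible_elem (c i j)) \<and>
     local_triangle_relations c \<and>
     local_exchange_relations m c"

end

theory Submission imports Defs begin

text \<open>
  Written out entrywise, (a) is the three-term relation
  \<open>c i (j+1) = c i j c (j-1) j\<inverse> c (j-1) (j+1) - c i (j-1) c j (j-1)\<inverse> c j (j+1)\<close>,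
  and (b) is its mirror image, which is the same relation with the two indices of \<open>c\<close> exchanged
  and all products reversed. Geometrically, (a) is the exchange relation for the
  diagonals \<open>i, j\<close> and \<open>j-1, j+1\<close>, solved for \<open>c i (j+1)\<close> with the help of the triangle relation for
  \<open>j-1, j, j+1\<close>. The hypotheses only contain exchange relations for quadrangles with two opposite
  boundary edges, so a propagation argument is needed.

  Propagation of (a) runs through the rows \<open>i = j+1, j+2, \<dots>, j+m-1\<close> with \<open>j\<close> fixed.
  For \<open>i = j+1\<close> the left hand side vanishes and the relation is the local triangle relation at
  \<open>j\<close> (\<open>row_propagation_at_succ\<close>). To pass from \<open>i\<close> to \<open>i+1\<close>, expand \<open>c (i+1) (j+1)\<close> and
  \<open>c (i+1) j\<close> by local exchange relations, which express them by the entries of row \<open>i\<close> up to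
  correction terms. The two correction terms match exactly if the triangle relation holds for the
  vertices \<open>i, j-1, j\<close> (\<open>row_propagation_step\<close>). For (b) the column \<open>k\<close> runs from \<open>i+1\<close> to
  \<open>i+m-1\<close> in the same way.

  What remains is that the triangle relation holds for every triangle with a boundary edge,
  not only for consecutive vertices (\<open>triangle_boundary_edge\<close>). In a quadrangle whose opposite
  edges \<open>i, i+1\<close> and \<open>j, j+1\<close> are boundary edges, two exchange relations show that, once the
  triangle \<open>i, i+1, j\<close> satisfies the relation, the triangles \<open>i, j, j+1\<close> and \<open>i+1, j, j+1\<close> either
  both satisfy it or both do not (\<open>triangle_transfer\<close>). Induction on the length of the arc spanned
  by the triangle then starts from the local relations.
\<close>

section \<open>Inverses in a noncommutative ring\<close>

lemma inv_elem_inverse: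
  assumes "invertible_elem (x::'a::monoid_mult)"
  shows "x * inv_elem x = 1" "inv_elem x * x = 1"
proof -
  obtain y where y: "x * y = 1" "y * x = 1"
    using assms by (auto simp: invertible_elem_def)
  have unique: "z = y" if "x * z = 1 \<and> z * x = 1" for z
    using that y by (metis mult.assoc mult_1_left mult_1_right)
  have "inv_elem x = y"
    unfolding inv_elem_def by (rule the_equality) (blast intro: y unique)+
  then show "x * inv_elem x = 1" "inv_elem x * x = 1"
    using y by simp_all
qed

lemma inv_elem_cancel:
  assumes "invertible_elem (x::'a::monoid_mult)"
  shows "x * (inv_elem x * y) = y" "inv_elem x * (x * y) = y"
  by (simp_all add: inv_elem_inverse[OF assms] mult.assoc[symmetric])

lemmas inv_elem_simps = inv_elem_inverse inv_elem_cancel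

section \<open>Triangle relations\<close>

definition triangle :: "('v \<Rightarrow> 'v \<Rightarrow> 'a::monoid_mult) \<Rightarrow> 'v \<Rightarrow> 'v \<Rightarrow> 'v \<Rightarrow> bool" where
  "triangle c x y z \<longleftrightarrow> c y z * inv_elem (c x z) * c x y = c y x * inv_elem (c z x) * c z y"

lemma triangle_reverse: "triangle c x y z \<longleftrightarrow> triangle c z y x"
  by (auto simp: triangle_def)

text \<open>
  The two sides of the relation are products of invertible elements. The equation between their
  inverses has the factors in the positions needed to move the relation to another vertex.
\<close>

lemma triangle_inverted:
  assumes inv: "invertible_elem (c x y)" "invertible_elem (c y x)" "invertible_elem (c y z)"
      "invertible_elem (c z y)" "invertible_elem (c x z)" "invertible_elem (c z x)"
    and "triangle c x y z"
  shows "inv_elem (c x y) * c x z * inv_elem (c y z)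
       = inv_elem (c z y) * c z x * inv_elem (c y x)"
proof -
  let ?p = "inv_elem (c x y) * c x z * inv_elem (c y z)"
  let ?q = "inv_elem (c z y) * c z x * inv_elem (c y x)"
  let ?u = "c y z * inv_elem (c x z) * c x y"
  have u: "?u = c y x * inv_elem (c z x) * c z y"
    using assms(7) by (simp add: triangle_def)
  have "?p = ?p * (?u * ?q)"
    unfolding u by (simp add: mult.assoc inv_elem_simps[OF inv(1)] inv_elem_simps[OF inv(2)]
        inv_elem_simps[OF inv(3)] inv_elem_simps[OF inv(4)] inv_elem_simps[OF inv(5)]
        inv_elem_simps[OF inv(6)])
  also have "\<dots> = ?q"
    by (simp add: mult.assoc inv_elem_simps[OF inv(1)] inv_elem_simps[OF inv(2)]
        inv_elem_simps[OF inv(3)] inv_elem_simps[OF inv(4)] inv_elem_simps[OF inv(5)]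
        inv_elem_simps[OF inv(6)])
  finally show ?thesis .
qed

lemma triangle_rotate:
  assumes inv: "invertible_elem (c x y)" "invertible_elem (c y x)" "invertible_elem (c y z)"
      "invertible_elem (c z y)" "invertible_elem (c x z)" "invertible_elem (c z x)"
    and "triangle c x y z"
  shows "triangle c y z x"
proof -
  have "c z x * inv_elem (c y x) * c y z
      = c z y * (inv_elem (c z y) * c z x * inv_elem (c y x)) * c y z"
    by (simp add: mult.assoc inv_elem_simps[OF inv(4)])
  also have "\<dots> = c z y * (inv_elem (c x y) * c x z * inv_elem (c y z)) * c y z"
    by (simp only: triangle_inverted[OF assms])
  also have "\<dots> = c z y * inv_elem (c x y) * c x z"
    by (simp add: mult.assoc inv_elem_simps[OF inv(3)])
  finally show ?thesis by (simp add: triangle_def)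
qed

text \<open>
  Expanding \<open>c b y\<close> and \<open>c y b\<close> on the two sides of the triangle relation for \<open>b, x, y\<close> produces
  the two sides of the relation for \<open>a, x, y\<close>, plus one further term on each side. These extra
  terms agree by the relation for \<open>a, b, x\<close>.
\<close>

lemma triangle_transfer:
  fixes c :: "'v \<Rightarrow> 'v \<Rightarrow> 'a::{ring, monoid_mult}"
  assumes inv: "invertible_elem (c a b)" "invertible_elem (c b a)" "invertible_elem (c b x)"
      "invertible_elem (c x b)" "invertible_elem (c a x)" "invertible_elem (c x a)"
    and by_eq: "c b y = c b a * inv_elem (c x a) * c x y + c b x * inv_elem (c a x) * c a y"
    and yb_eq: "c y b = c y x * inv_elem (c a x) * c a b + c y a * inv_elem (c x a) * c x b"
    and xba: "triangle c x b a"
  shows "triangle c a y x \<longleftrightarrow> triangle c b y x"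
proof -
  have "triangle c b a x"
    by (rule triangle_rotate[OF inv(4,3,2,1,6,5) xba])
  then have "triangle c a x b"
    by (rule triangle_rotate[OF inv(2,1,5,6,3,4)])
  then have key: "inv_elem (c b x) * c b a * inv_elem (c x a)
           = inv_elem (c a x) * c a b * inv_elem (c x b)"
    by (rule triangle_inverted[OF inv(5,6,4,3,1,2), symmetric])
  have l: "c y x * inv_elem (c b x) * c b y
      = c y x * (inv_elem (c b x) * c b a * inv_elem (c x a)) * c x y
        + c y x * inv_elem (c a x) * c a y"
    unfolding by_eq by (simp add: distrib_left mult.assoc inv_elem_simps[OF inv(3)])
  have r: "c y b * inv_elem (c x b) * c x y
      = c y x * (inv_elem (c a x) * c a b * inv_elem (c x b)) * c x y
        + c y a * inv_elem (c x a) * c x y"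
    unfolding yb_eq by (simp add: distrib_right mult.assoc inv_elem_simps[OF inv(4)])
  show ?thesis
    unfolding triangle_def l r key by simp
qed

locale nc_frieze =
  fixes m :: nat and c :: "int \<Rightarrow> int \<Rightarrow> 'a::{ring, monoid_mult}"
  assumes m3: "m \<ge> 3" and frieze: "nc_frieze_pattern m c"
begin

lemma diag: "c i i = 0"
  using frieze by (simp add: nc_frieze_pattern_def)

lemma periodic: "[i = i'] (mod int m) \<Longrightarrow> [j = j'] (mod int m) \<Longrightarrow> c i j = c i' j'"
  using frieze by (auto simp: nc_frieze_pattern_def indexed_mod_def)

lemma not_cong:
  assumes "a \<noteq> b" "\<bar>a - b\<bar> < int m"
  shows "\<not> [a = b] (mod int m)"
  using assms dvd_imp_le_int[of "a - b" "int m"] by (auto simp: cong_iff_dvd_diff)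

lemma invertible: "i \<noteq> j \<Longrightarrow> \<bar>i - j\<bar> < int m \<Longrightarrow> invertible_elem (c i j)"
  using frieze not_cong[of j i] by (simp add: nc_frieze_pattern_def abs_minus_commute)

lemma exchange_distinct:
  assumes "\<not> [j = i] (mod int m)" "\<not> [j = i + 1] (mod int m)" "\<not> [j + 1 = i] (mod int m)"
  shows "c (i+1) (j+1) = c (i+1) i * inv_elem (c j i) * c j (j+1)
           + c (i+1) j * inv_elem (c i j) * c i (j+1)"
    and "c (j+1) (i+1) = c (j+1) j * inv_elem (c i j) * c i (i+1)
           + c (j+1) i * inv_elem (c j i) * c j (i+1)"
proof -
  have "local_exchange_relations m c"
    using frieze by (simp add: nc_frieze_pattern_def)
  note * = this[unfolded local_exchange_relations_def, rule_format, OF assms]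
  from * show "c (i+1) (j+1) = c (i+1) i * inv_elem (c j i) * c j (j+1)
           + c (i+1) j * inv_elem (c i j) * c i (j+1)"
    by blast
  from * show "c (j+1) (i+1) = c (j+1) j * inv_elem (c i j) * c i (i+1)
           + c (j+1) i * inv_elem (c j i) * c j (i+1)"
    by blast
qed

text \<open>
  The relation survives the degeneration of the quadrangle to a triangle, where an entry on the
  diagonal kills one of the two terms. Propagation meets these cases at both of its ends.
\<close>

lemma exchange:
  assumes "\<not> [j = i] (mod int m)"
  shows "c (i+1) (j+1) = c (i+1) i * inv_elem (c j i) * c j (j+1)
           + c (i+1) j * inv_elem (c i j) * c i (j+1)"
proof -
  consider "[j + 1 = i] (mod int m)" | "[j = i + 1] (mod int m)"
    | "\<not> [j = i + 1] (mod int m)" "\<not> [j + 1 = i] (mod int m)"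
    by blast
  then show ?thesis
  proof cases
    case 1
    then have eq: "c k (j+1) = c k i" for k
      by (intro periodic) simp_all
    have "invertible_elem (c j i)"
      using frieze assms by (auto simp: nc_frieze_pattern_def cong_sym_eq)
    then show ?thesis
      by (simp add: eq diag mult.assoc inv_elem_simps)
  next
    case 2
    then have eq: "c (i+1) k = c j k" for k
      by (intro periodic) (simp_all add: cong_sym_eq)
    have "invertible_elem (c j i)"
      using frieze assms by (auto simp: nc_frieze_pattern_def cong_sym_eq)
    then show ?thesis
      by (simp add: eq diag inv_elem_simps)
  next
    case 3
    then show ?thesis
      using assms by (intro exchange_distinct(1))
  qed
qed

text \<open>
  Both families of triangles, those with their boundary edge at the end and those with their
  boundary edge at the start of the arc, have to be carried through the induction: a triangle
  of one family is lengthened with the help of a triangle of the other.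
\<close>

lemma triangle_boundary_edge_nat:
  assumes "n + 2 < m"
  shows "triangle c i (i + int n + 2) (i + int n + 1) \<and>
         triangle c (i + int n + 2) (i + 1) i"
  using assms
proof (induction n arbitrary: i)
  case 0
  have "local_triangle_relations c"
    using frieze by (simp add: nc_frieze_pattern_def)
  then have 1: "triangle c i (i+1) (i+2)"
    by (simp add: local_triangle_relations_def triangle_def)
  have "triangle c (i+1) (i+2) i"
    by (rule triangle_rotate[OF _ _ _ _ _ _ 1]; rule invertible) (use m3 in auto)
  then show ?case
    using 1 triangle_reverse by (metis add_0_right of_nat_0)
next
  case (Suc n)
  define j where "j = i + int n + 2"
  have idx: "(i + 1) + int n + 2 = j + 1" "(i + 1) + int n + 1 = j"
    "i + int (Suc n) + 2 = j + 1" "i + int (Suc n) + 1 = j" "i + int n + 2 = j"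
    by (simp_all add: j_def)
  have T1: "triangle c (i+1) (j+1) j"
    using Suc.IH[of "i+1"] Suc.prems idx by simp
  have T2: "triangle c j (i+1) i"
    using Suc.IH[of i] Suc.prems idx by simp
  have inv: "invertible_elem (c a b)"
    if "a \<in> {i, i+1, j, j+1}" "b \<in> {i, i+1, j, j+1}" "a \<noteq> b" for a b
    using that Suc.prems by (intro invertible) (auto simp: j_def)
  have nc: "\<not> [j = i] (mod int m)" "\<not> [j = i+1] (mod int m)" "\<not> [j + 1 = i] (mod int m)"
    "\<not> [i = j] (mod int m)" "\<not> [i = j+1] (mod int m)" "\<not> [i + 1 = j] (mod int m)"
    by (rule not_cong; use Suc.prems in \<open>simp add: j_def\<close>)+
  have T3: "triangle c i (j+1) j"
    by (rule triangle_transfer[of c i "i+1" j "j+1", THEN iffD2])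
      (rule inv exchange_distinct[OF nc(1-3)] T1 T2; simp add: j_def)+
  \<comment> \<open>The same transfer, with the two boundary edges of the quadrangle interchanged.\<close>
  have "triangle c (j+1) (i+1) i"
    by (rule triangle_transfer[of c j "j+1" i "i+1", THEN iffD1])
      (rule inv exchange_distinct[OF nc(4-6)] T2 T3; simp add: j_def)+
  then show ?case
    using T3 unfolding idx by blast
qed

lemma triangle_boundary_edge:
  assumes "j + 1 < k" "k < j + int m"
  shows "triangle c k (j + 1) j"
proof -
  have "j + int (nat (k - j - 2)) + 2 = k"
    using assms by simp
  then show ?thesis
    using triangle_boundary_edge_nat[of "nat (k - j - 2)" j] assms by simp
qed

section \<open>Propagation along rows\<close>

definition row_propagation :: "int \<Rightarrow> int \<Rightarrow> bool" where
  "row_propagation j i \<longleftrightarrow>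
     c i (j+1) = c i j * (inv_elem (c (j-1) j) * c (j-1) (j+1))
               - c i (j-1) * (inv_elem (c j (j-1)) * c j (j+1))"

lemma row_propagation_at_succ: "row_propagation j (j+1)"
proof -
  have inv: "invertible_elem (c (j+1) j)" "invertible_elem (c (j-1) j)"
    "invertible_elem (c j (j-1))" "invertible_elem (c j (j+1))"
    "invertible_elem (c (j-1) (j+1))" "invertible_elem (c (j+1) (j-1))"
    using m3 by (auto intro!: invertible)
  have "triangle c (j+1) j (j-1)"
    using triangle_boundary_edge[of "j-1" "j+1"] m3 by simp
  then have "triangle c j (j-1) (j+1)"
    by (rule triangle_rotate[OF inv(1,4,3,2,6,5)])
  then have "triangle c (j-1) (j+1) j"
    by (rule triangle_rotate[OF inv(3,2,5,6,4,1)])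
  then show ?thesis
    by (simp add: row_propagation_def triangle_def diag mult.assoc)
qed

text \<open>
  In the expansion of \<open>c (i+1) (j+1)\<close>, the relation for row \<open>i\<close> replaces \<open>c i (j+1)\<close> by entries further
  left. This gives the relation for row \<open>i + 1\<close>, except that \<open>c (i+1) (j-1)\<close> appears as
  \<open>c (i+1) j c i j\<inverse> c i (j-1)\<close> minus a correction term; the exchange relation one column to the
  left identifies this difference.
\<close>

lemma row_propagation_step:
  assumes "j < i" "i + 1 < j + int m" and prev: "row_propagation j i"
  shows "row_propagation j (i+1)"
proof -
  let ?A = "inv_elem (c j (j-1)) * c j (j+1)"
  let ?B = "inv_elem (c (j-1) j) * c (j-1) (j+1)"
  have inv: "invertible_elem (c i j)" "invertible_elem (c j i)"
    "invertible_elem (c (j-1) j)" "invertible_elem (c j (j-1))"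
    "invertible_elem (c i (j-1))" "invertible_elem (c (j-1) i)"
    using assms(1,2) m3 by (auto intro!: invertible)
  have "triangle c i j (j-1)"
    using triangle_boundary_edge[of "j-1" i] assms(1,2) by simp
  then have tri: "c j (j-1) * inv_elem (c i (j-1)) * c i j
      = c j i * inv_elem (c (j-1) i) * c (j-1) j"
    by (simp add: triangle_def)
  have "c (j-1) j * inv_elem (c i j) * c i (j-1)
      = c (j-1) i * inv_elem (c j i) * (c j i * inv_elem (c (j-1) i) * c (j-1) j)
          * inv_elem (c i j) * c i (j-1)"
    by (simp add: mult.assoc inv_elem_simps[OF inv(2)] inv_elem_simps[OF inv(6)])
  also have "\<dots> = c (j-1) i * inv_elem (c j i) * c j (j-1)"
    unfolding tri[symmetric]
    by (simp add: mult.assoc inv_elem_simps[OF inv(1)] inv_elem_simps[OF inv(5)])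
  finally have tri': "c (j-1) j * inv_elem (c i j) * c i (j-1)
      = c (j-1) i * inv_elem (c j i) * c j (j-1)" .
  \<comment> \<open>Solve the exchange relation one column to the left for \<open>c (i+1) (j-1)\<close>. The triangle relation
      gives the correction term the same left factor \<open>c (i+1) i c j i\<inverse>\<close> that occurs in the
      expansion of \<open>c (i+1) (j+1)\<close>.\<close>
  have "c (i+1) j = c (i+1) i * inv_elem (c (j-1) i) * c (j-1) j
      + c (i+1) (j-1) * inv_elem (c i (j-1)) * c i j"
    using exchange[of "j-1" i] not_cong[of "j-1" i] assms(1,2) by simp
  then have "c (i+1) j * inv_elem (c i j) * c i (j-1)
      = c (i+1) i * inv_elem (c (j-1) i) * (c (j-1) j * inv_elem (c i j) * c i (j-1))
        + c (i+1) (j-1)"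
    by (simp add: distrib_right mult.assoc inv_elem_simps[OF inv(1)] inv_elem_simps[OF inv(5)])
  then have left: "c (i+1) j * inv_elem (c i j) * c i (j-1)
      = c (i+1) i * inv_elem (c j i) * c j (j-1) + c (i+1) (j-1)"
    unfolding tri' by (simp add: mult.assoc inv_elem_simps[OF inv(6)])
  have "c (i+1) (j+1) = c (i+1) i * inv_elem (c j i) * c j (j+1)
      + c (i+1) j * inv_elem (c i j) * (c i j * ?B - c i (j-1) * ?A)"
    using exchange[of j i] not_cong[of j i] assms(1,2) prev by (simp add: row_propagation_def)
  also have "\<dots> = c (i+1) i * inv_elem (c j i) * c j (j+1) + c (i+1) j * ?B
      - (c (i+1) j * inv_elem (c i j) * c i (j-1)) * ?A"
    by (simp add: right_diff_distrib mult.assoc inv_elem_simps[OF inv(1)])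
  also have "\<dots> = c (i+1) j * ?B - c (i+1) (j-1) * ?A"
    unfolding left by (simp add: distrib_right mult.assoc inv_elem_simps[OF inv(4)])
  finally show ?thesis
    by (simp add: row_propagation_def)
qed

text \<open>Any class modulo \<open>m\<close> other than that of \<open>a\<close> is reached from \<open>a + 1\<close> by at most \<open>m - 2\<close> steps.\<close>

lemma propagate:
  assumes base: "P (a + 1)"
    and step: "\<And>b. a < b \<Longrightarrow> b + 1 < a + int m \<Longrightarrow> P b \<Longrightarrow> P (b + 1)"
    and mod: "\<And>b b'. [b = b'] (mod int m) \<Longrightarrow> P b \<Longrightarrow> P b'"
    and b: "\<not> [b = a] (mod int m)"
  shows "P b"
proof -
  have P: "a + 1 + int n < a + int m \<Longrightarrow> P (a + 1 + int n)" for n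
  proof (induction n)
    case 0
    then show ?case by (simp add: base)
  next
    case (Suc n)
    then show ?case
      using step[of "a + 1 + int n"] by (simp add: add.commute add.left_commute)
  qed
  define r where "r = (b - a) mod int m"
  have "r \<noteq> 0"
    using b by (auto simp: r_def cong_iff_dvd_diff)
  moreover have "0 \<le> r" "r < int m"
    using m3 by (simp_all add: r_def)
  ultimately have "P (a + r)"
    using P[of "nat (r - 1)"] by simp
  moreover have "[a + r = b] (mod int m)"
    by (simp add: r_def cong_def mod_simps)
  ultimately show ?thesis
    using mod by blast
qed

lemma row_propagation_all:
  assumes "\<not> [j = i] (mod int m)"
  shows "row_propagation j i"
proof (rule propagate[where a = j])
  show "row_propagation j (j + 1)"
    by (rule row_propagation_at_succ)
next
  fix b assume "j < b" "b + 1 < j + int m" "row_propagation j b"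
  then show "row_propagation j (b + 1)"
    by (rule row_propagation_step)
next
  fix b b' assume "[b = b'] (mod int m)" "row_propagation j b"
  moreover from this have "c b k = c b' k" for k
    by (intro periodic) simp_all
  ultimately show "row_propagation j b'"
    by (simp add: row_propagation_def)
qed (use assms in \<open>simp add: cong_sym_eq\<close>)

section \<open>Propagation along columns\<close>

definition column_propagation :: "int \<Rightarrow> int \<Rightarrow> bool" where
  "column_propagation i k \<longleftrightarrow>
     c (i+1) k = c (i+1) (i-1) * inv_elem (c i (i-1)) * c i k
               - c (i+1) i * inv_elem (c (i-1) i) * c (i-1) k"

text \<open>
  For the entry \<open>c (i+1) (i+1) = 0\<close> the row relation and the column relation equate the same two
  products, with opposite signs.
\<close>

lemma column_propagation_at_succ: "column_propagation i (i+1)"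
  using row_propagation_at_succ[of i]
  by (simp add: row_propagation_def column_propagation_def diag mult.assoc)

text \<open>
  The mirror image of the row step: \<open>c (i+1) k\<close> in the expansion of \<open>c (i+1) (k+1)\<close> is replaced by
  the entries above it in column \<open>k\<close>, and the exchange relation one row higher produces
  \<open>c (i-1) (k+1)\<close>.
\<close>

lemma column_propagation_step:
  assumes "i < k" "k + 1 < i + int m" and prev: "column_propagation i k"
  shows "column_propagation i (k+1)"
proof -
  let ?A = "c (i+1) i * inv_elem (c (i-1) i)"
  let ?B = "c (i+1) (i-1) * inv_elem (c i (i-1))"
  have inv: "invertible_elem (c i k)" "invertible_elem (c k i)"
    "invertible_elem (c (i-1) i)" "invertible_elem (c i (i-1))"
    "invertible_elem (c k (i-1))" "invertible_elem (c (i-1) k)"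
    using assms(1,2) m3 by (auto intro!: invertible)
  have "triangle c k i (i-1)"
    using triangle_boundary_edge[of "i-1" k] assms(1,2) by simp
  then have tri: "c i (i-1) * inv_elem (c k (i-1)) * c k i
      = c i k * inv_elem (c (i-1) k) * c (i-1) i"
    by (simp add: triangle_def)
  have "c (i-1) k * inv_elem (c i k) * c i (i-1) * inv_elem (c k (i-1))
      = c (i-1) k * inv_elem (c i k) * (c i (i-1) * inv_elem (c k (i-1)) * c k i)
          * inv_elem (c k i)"
    by (simp add: mult.assoc inv_elem_simps[OF inv(2)])
  also have "\<dots> = c (i-1) i * inv_elem (c k i)"
    unfolding tri
    by (simp add: mult.assoc inv_elem_simps[OF inv(1)] inv_elem_simps[OF inv(6)])
  finally have tri': "c (i-1) k * inv_elem (c i k) * c i (i-1) * inv_elem (c k (i-1))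
      = c (i-1) i * inv_elem (c k i)" .
  have "c i (k+1) = c i (i-1) * inv_elem (c k (i-1)) * c k (k+1)
      + c i k * inv_elem (c (i-1) k) * c (i-1) (k+1)"
    using exchange[of k "i-1"] not_cong[of k "i-1"] assms(1,2) by simp
  then have "c (i-1) k * inv_elem (c i k) * c i (k+1)
      = (c (i-1) k * inv_elem (c i k) * c i (i-1) * inv_elem (c k (i-1))) * c k (k+1)
        + c (i-1) (k+1)"
    by (simp add: distrib_left mult.assoc inv_elem_simps[OF inv(1)] inv_elem_simps[OF inv(6)])
  then have above: "c (i-1) k * inv_elem (c i k) * c i (k+1)
      = c (i-1) i * inv_elem (c k i) * c k (k+1) + c (i-1) (k+1)"
    unfolding tri' .
  have "c (i+1) (k+1) = c (i+1) i * inv_elem (c k i) * c k (k+1)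
      + (?B * c i k - ?A * c (i-1) k) * inv_elem (c i k) * c i (k+1)"
    using exchange[of k i] not_cong[of k i] assms(1,2) prev by (simp add: column_propagation_def)
  also have "\<dots> = c (i+1) i * inv_elem (c k i) * c k (k+1) + ?B * c i (k+1)
      - ?A * (c (i-1) k * inv_elem (c i k) * c i (k+1))"
    by (simp add: left_diff_distrib mult.assoc inv_elem_simps[OF inv(1)])
  also have "\<dots> = ?B * c i (k+1) - ?A * c (i-1) (k+1)"
    unfolding above by (simp add: distrib_left mult.assoc inv_elem_simps[OF inv(3)])
  finally show ?thesis
    by (simp add: column_propagation_def)
qed

lemma column_propagation_all:
  assumes "\<not> [k = i] (mod int m)"
  shows "column_propagation i k"
proof (rule propagate[where a = i])
  show "column_propagation i (i + 1)"
    by (rule column_propagation_at_succ)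
next
  fix b assume "i < b" "b + 1 < i + int m" "column_propagation i b"
  then show "column_propagation i (b + 1)"
    by (rule column_propagation_step)
next
  fix b b' assume "[b = b'] (mod int m)" "column_propagation i b"
  moreover from this have "c k b = c k b'" for k
    by (intro periodic) simp_all
  ultimately show "column_propagation i b'"
    by (simp add: column_propagation_def)
qed (use assms in simp)

end

section \<open>The matrix form\<close>

lemma row_times_matrix:
  fixes x y :: "'a::semiring_0"
  shows "mat_of_rows_list 2 [[x, y]] * mat_of_rows_list 2 [[a, b], [d, e]]
       = mat_of_rows_list 2 [[x * a + y * d, x * b + y * e]]"
  by (rule eq_matI)
    (auto simp: mat_of_rows_list_def scalar_prod_def less_Suc_eq numeral_2_eq_2)

lemma matrix_times_column:
  fixes x y :: "'a::semiring_0"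
  shows "mat_of_rows_list 2 [[a, b], [d, e]] * mat_of_rows_list 1 [[x], [y]]
       = mat_of_rows_list 1 [[a * x + b * y], [d * x + e * y]]"
  by (rule eq_matI)
    (auto simp: mat_of_rows_list_def scalar_prod_def less_Suc_eq numeral_2_eq_2)

theorem theorem6p3:
  fixes m :: nat and c :: "int \<Rightarrow> int \<Rightarrow> 'a::{ring, monoid_mult}"
  assumes "m \<ge> 3" and "nc_frieze_pattern m c"
  shows
    "(\<forall>i j. \<not> [j = i] (mod int m) \<longrightarrow>
        mat_of_rows_list 2 [[c i (j-1), c i j]] *
        mat_of_rows_list 2
          [[0, - (inv_elem (c j (j-1)) * c j (j+1))],
           [1, inv_elem (c (j-1) j) * c (j-1) (j+1)]]
        = mat_of_rows_list 2 [[c i j, c i (j+1)]]) \<and>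
     (\<forall>i k. \<not> [k = i] (mod int m) \<longrightarrow>
        mat_of_rows_list 2
          [[0, 1],
           [- (c (i+1) i * inv_elem (c (i-1) i)), c (i+1) (i-1) * inv_elem (c i (i-1))]] *
        mat_of_rows_list 1 [[c (i-1) k], [c i k]]
        = mat_of_rows_list 1 [[c i k], [c (i+1) k]])"
proof -
  interpret nc_frieze m c
    using assms by unfold_locales
  show ?thesis
    using row_propagation_all column_propagation_all
    by (auto simp: row_times_matrix matrix_times_column row_propagation_def
        column_propagation_def mult.assoc simp del: One_nat_def)
qed

end
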